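(* Let $n\geq 1$ be an integer and let $(x_i)_{1\le i\le n}$, $(y_j)_{1\le j\le 2n}$, $(z_i)_{1\le i\le n}$ be real-valued random variables, where the $x_i$ are iid with the distribution of $X$ (treatment group $T_1$), the $y_j$ are iid with the distribution of $Y$ (control group $C$), and the $z_i$ are iid with the distribution of $Z$ (treatment group $T_2$), and where the three families $(x_i)$, $(y_j)$, $(z_i)$ are mutually independent. Suppose that the standard deviations of $X$, $Y$ and $Z$ are finite, the same and known: $\sigma := \sigma_X=\sigma_Y=\sigma_Z>0$. Let $A,B\subseteq [2n]=\{1,\dots,2n\}$ be fixed subsets of size $n$ and let $k=|A\cap B|$. Put $$t_1=\frac{\overline{x}-\overline{y_A}}{\sqrt{2\sigma^2 n^{-1}}},\qquad t_2=\frac{\overline{z}-\overline{y_B}}{\sqrt{2\sigma^2 n^{-1}}}.$$ Then $$\mathrm{cov}(t_1,t_2)=\frac{k}{2n}\geq 0,$$ and the Pearson correlation of $t_1$ and $t_2$ satisfies $$\rho(t_1,t_2)=\frac{k}{2n}.$$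
   Context: Here $\overline{x}=\frac1n\sum_{i=1}^n x_i$, $\overline{z}=\frac1n\sum_{i=1}^n z_i$, $\overline{y_A}=\frac1n\sum_{j\in A}y_j$ and $\overline{y_B}=\frac1n\sum_{j\in B}y_j$ are sample means. The statistics $t_1,t_2$ are the two-sample $z$-statistics for comparing $T_1$ with the control units in $A$ and $T_2$ with the control units in $B$, respectively. *)

theory Defs
  imports "HOL-Probability.Probability"
begin

context prob_space
begin

text \<open>
  Finiteness is required explicitly because the Bochner integral, and hence \<open>expectation\<close>,
  of a non-integrable function is 0 by convention.
\<close>

definition finite_sd :: "('a \<Rightarrow> real) \<Rightarrow> bool" where
  "finite_sd X \<longleftrightarrow> random_variable borel X \<and> integrable M X \<and>
     integrable M (\<lambda>\<omega>. (X \<omega> - expectation X)\<^sup>2)"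

definition sd :: "('a \<Rightarrow> real) \<Rightarrow> real" where
  "sd X = sqrt (variance X)"

definition covariance :: "('a \<Rightarrow> real) \<Rightarrow> ('a \<Rightarrow> real) \<Rightarrow> real" where
  "covariance U V = expectation (\<lambda>\<omega>. (U \<omega> - expectation U) * (V \<omega> - expectation V))"

definition correlation :: "('a \<Rightarrow> real) \<Rightarrow> ('a \<Rightarrow> real) \<Rightarrow> real" where
  "correlation U V = covariance U V / (sd U * sd V)"

definition iid :: "real measure \<Rightarrow> 'i set \<Rightarrow> ('i \<Rightarrow> 'a \<Rightarrow> real) \<Rightarrow> bool" where
  "iid D I u \<longleftrightarrow> indep_vars (\<lambda>_. borel) u I \<and> (\<forall>i\<in>I. distr M borel (u i) = D)"

text \<open>
  The families \<open>(u g i)\<^sub>i\<close> with \<open>i \<in> I g\<close>, one for each label \<open>g \<in> G\<close>, are mutually independent: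
  each family is viewed as one random vector with values in the product space over \<open>I g\<close>,
  and these vectors are independent. Nothing is asserted about the members of a single family.
\<close>

definition indep_families :: "('g \<Rightarrow> 'i set) \<Rightarrow> ('g \<Rightarrow> 'i \<Rightarrow> 'a \<Rightarrow> real) \<Rightarrow> 'g set \<Rightarrow> bool" where
  "indep_families I u G \<longleftrightarrow>
     indep_vars (\<lambda>g. \<Pi>\<^sub>M i\<in>I g. borel) (\<lambda>g \<omega>. \<lambda>i\<in>I g. u g i \<omega>) G"

end

datatype group_label = T1 | C | T2

definition sample_mean :: "nat \<Rightarrow> nat set \<Rightarrow> (nat \<Rightarrow> 'a \<Rightarrow> real) \<Rightarrow> 'a \<Rightarrow> real" where
  "sample_mean n I u \<omega> = (1 / real n) * (\<Sum>i\<in>I. u i \<omega>)"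

text \<open>Both groups have size \<open>n\<close> and known common standard deviation \<open>\<sigma>\<close>.\<close>

definition z_statistic ::
  "nat \<Rightarrow> real \<Rightarrow> nat set \<Rightarrow> (nat \<Rightarrow> 'a \<Rightarrow> real) \<Rightarrow> nat set \<Rightarrow> (nat \<Rightarrow> 'a \<Rightarrow> real) \<Rightarrow> 'a \<Rightarrow> real" where
  "z_statistic n \<sigma> I u J v \<omega> =
     (sample_mean n I u \<omega> - sample_mean n J v \<omega>) / sqrt (2 * \<sigma>\<^sup>2 * inverse (real n))"

end

theory Submission
  imports Defs
begin

text \<open>
  The observations, indexed by pairs of a group label and an index, are pairwise uncorrelated with
  common variance \<open>\<sigma>\<^sup>2\<close>. Both statistics are linear combinations of them with
  coefficients \<open>\<plusminus>c\<close>, \<open>2n c\<^sup>2 \<sigma>\<^sup>2 = 1\<close>, so their covariance is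
  \<open>\<sigma>\<^sup>2\<close> times the inner product of the coefficient vectors, whose supports share exactly the
  \<open>k\<close> control units in \<open>A \<inter> B\<close>; each coefficient vector has \<open>2n\<close> nonzero entries, so both
  variances are 1.
\<close>

section \<open>Moments depend only on the distribution\<close>

lemma finite_sd_iff_of_distr_eq:
  fixes X :: "'a \<Rightarrow> real" and Y :: "'b \<Rightarrow> real"
  assumes "prob_space M" "prob_space N"
    and [measurable]: "X \<in> borel_measurable M" "Y \<in> borel_measurable N"
    and eq: "distr M borel X = distr N borel Y"
  shows "prob_space.finite_sd M X \<longleftrightarrow> prob_space.finite_sd N Y"
proof -
  interpret M: prob_space M by fact
  interpret N: prob_space N by fact
  have "integrable M (\<lambda>\<omega>. f (X \<omega>)) \<longleftrightarrow> integrable N (\<lambda>\<omega>. f (Y \<omega>))"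
    if [measurable]: "f \<in> borel_measurable borel" for f :: "real \<Rightarrow> real"
    using integrable_distr_eq[of X M borel f] integrable_distr_eq[of Y N borel f] eq by simp
  \<comment> \<open>Both quadratic deviations are centred at the mean of \<open>X\<close>, so that
    one function \<open>f\<close> serves on both spaces. Once the two means are shown to agree, the
    deviation of \<open>Y\<close> is centred at its own mean, as \<open>finite_sd\<close>
    requires.\<close>
  from this[of "\<lambda>t. t"] this[of "\<lambda>t. (t - M.expectation X)\<^sup>2"]
  have ints: "integrable M X \<longleftrightarrow> integrable N Y"
    "integrable M (\<lambda>\<omega>. (X \<omega> - M.expectation X)\<^sup>2) \<longleftrightarrow>
      integrable N (\<lambda>\<omega>. (Y \<omega> - M.expectation X)\<^sup>2)"
    by simp_all
  have "integral\<^sup>L (distr M borel X) (\<lambda>t. t) = M.expectation X"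
    "integral\<^sup>L (distr N borel Y) (\<lambda>t. t) = N.expectation Y"
    by (rule integral_distr; simp)+
  then have "M.expectation X = N.expectation Y"
    unfolding eq by (rule trans[OF sym])
  with ints show ?thesis
    by (simp add: M.finite_sd_def N.finite_sd_def)
qed

lemma sd_eq_of_distr_eq:
  fixes X :: "'a \<Rightarrow> real" and Y :: "'b \<Rightarrow> real"
  assumes "prob_space M" "prob_space N"
    and [measurable]: "X \<in> borel_measurable M" "Y \<in> borel_measurable N"
    and eq: "distr M borel X = distr N borel Y"
  shows "prob_space.sd M X = prob_space.sd N Y"
proof -
  interpret M: prob_space M by fact
  interpret N: prob_space N by fact
  have "M.expectation (\<lambda>\<omega>. f (X \<omega>)) = N.expectation (\<lambda>\<omega>. f (Y \<omega>))"
    if [measurable]: "f \<in> borel_measurable borel" for f :: "real \<Rightarrow> real"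
    using integral_distr[of X M borel f] integral_distr[of Y N borel f] eq by simp
  from this[of "\<lambda>t. t"] this[of "\<lambda>t. (t - M.expectation X)\<^sup>2"] show ?thesis
    by (simp add: M.sd_def N.sd_def)
qed

section \<open>Covariances of linear combinations\<close>

context prob_space
begin

lemma covariance_self: "covariance U U = (sd U)\<^sup>2"
  by (simp add: covariance_def sd_def power2_eq_square)

lemma covariance_indep_var:
  assumes "indep_var borel U borel V" "integrable M U" "integrable M V"
  shows "covariance U V = 0"
proof -
  have "indep_var borel ((\<lambda>t. t - expectation U) \<circ> U) borel ((\<lambda>t. t - expectation V) \<circ> V)"
    by (rule indep_var_compose[OF assms(1)]) simp_all
  from indep_var_lebesgue_integral[OF this] assms(2,3) show ?thesis
    by (simp add: covariance_def comp_def prob_space)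
qed

text \<open>The sum of the two squared deviations dominates the product, since 2|s||t| is at most
  s^2 + t^2. This is what allows expectations of double sums of such products to be taken term by
  term.\<close>

lemma integrable_centered_mult:
  assumes "finite_sd U" "finite_sd V"
  shows "integrable M (\<lambda>\<omega>. (U \<omega> - expectation U) * (V \<omega> - expectation V))"
proof (rule Bochner_Integration.integrable_bound)
  show "integrable M (\<lambda>\<omega>. (U \<omega> - expectation U)\<^sup>2 + (V \<omega> - expectation V)\<^sup>2)"
    using assms by (simp add: finite_sd_def)
  show "(\<lambda>\<omega>. (U \<omega> - expectation U) * (V \<omega> - expectation V)) \<in> borel_measurable M"
    using assms by (auto simp: finite_sd_def)
  have "\<bar>s * t\<bar> \<le> s\<^sup>2 + t\<^sup>2" for s t :: real
    using sum_squares_bound[of "\<bar>s\<bar>" "\<bar>t\<bar>"] abs_ge_zero[of "s * t"]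
    unfolding abs_mult power2_abs by linarith
  then show "AE \<omega> in M. norm ((U \<omega> - expectation U) * (V \<omega> - expectation V))
      \<le> norm ((U \<omega> - expectation U)\<^sup>2 + (V \<omega> - expectation V)\<^sup>2)"
    by simp
qed

text \<open>Covariance is bilinear, and only the diagonal terms of the double sum survive. Taking
  one index set \<open>S\<close> for both combinations turns every covariance and variance needed
  later into an inner product of coefficient vectors.\<close>

lemma covariance_sum_uncorrelated:
  assumes "finite S"
    and sd: "\<And>p. p \<in> S \<Longrightarrow> finite_sd (u p)"
    and cov: "\<And>p q. p \<in> S \<Longrightarrow> q \<in> S \<Longrightarrow> covariance (u p) (u q) = (if p = q then v else 0)"
  shows "covariance (\<lambda>\<omega>. \<Sum>p\<in>S. a p * u p \<omega>) (\<lambda>\<omega>. \<Sum>p\<in>S. b p * u p \<omega>) = v * (\<Sum>p\<in>S. a p * b p)"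
proof -
  define w where "w p \<omega> = u p \<omega> - expectation (u p)" for p \<omega>
  have int: "integrable M (u p)" if "p \<in> S" for p
    using sd[OF that] by (simp add: finite_sd_def)
  have center: "(\<Sum>p\<in>S. f p * u p \<omega>) - expectation (\<lambda>\<omega>. \<Sum>p\<in>S. f p * u p \<omega>) = (\<Sum>p\<in>S. f p * w p \<omega>)"
    for f \<omega>
    by (simp add: int w_def right_diff_distrib sum_subtractf)
  have intw: "integrable M (\<lambda>\<omega>. w p \<omega> * w q \<omega>)" if "p \<in> S" "q \<in> S" for p q
    unfolding w_def by (intro integrable_centered_mult sd that)
  have "covariance (\<lambda>\<omega>. \<Sum>p\<in>S. a p * u p \<omega>) (\<lambda>\<omega>. \<Sum>p\<in>S. b p * u p \<omega>)
      = expectation (\<lambda>\<omega>. \<Sum>p\<in>S. \<Sum>q\<in>S. a p * b q * (w p \<omega> * w q \<omega>))"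
    unfolding covariance_def center by (simp add: sum_product mult_ac)
  also have "\<dots> = (\<Sum>p\<in>S. \<Sum>q\<in>S. a p * b q * covariance (u p) (u q))"
    using intw by (simp add: covariance_def w_def)
  also have "\<dots> = (\<Sum>p\<in>S. \<Sum>q\<in>S. if p = q then v * (a p * b q) else 0)"
    by (intro sum.cong refl) (simp add: cov)
  also have "\<dots> = v * (\<Sum>p\<in>S. a p * b p)"
    using \<open>finite S\<close> by (simp add: sum_distrib_left)
  finally show ?thesis .
qed

section \<open>Pairwise independence of the observations\<close>

lemma indep_vars_imp_indep_var:
  assumes "indep_vars N X I" "i \<in> I" "j \<in> I" "i \<noteq> j"
  shows "indep_var (N i) (X i) (N j) (X j)"
proof -
  \<comment> \<open>Restriction to the disjoint index sets {i} and {j} yields two independent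
    one-coordinate vectors, and evaluation recovers the variables. The spaces \<open>N i\<close> may
    vary with the index, which covers both the real variables of one family and the vectors in
    \<open>indep_families\<close>.\<close>
  have "indep_var (N i) ((\<lambda>f. f i) \<circ> (\<lambda>\<omega>. \<lambda>i\<in>{i}. X i \<omega>))
      (N j) ((\<lambda>f. f j) \<circ> (\<lambda>\<omega>. \<lambda>i\<in>{j}. X i \<omega>))"
    using assms by (intro indep_var_compose[OF indep_var_restrict[OF assms(1), of "{i}" "{j}"]])
      (auto intro: measurable_component_singleton)
  then show ?thesis
    by (simp add: comp_def)
qed

text \<open>Coordinate projections are measurable, so independence of two whole families, seen as
  random vectors, passes to any coordinate of one and any coordinate of the other.\<close>

lemma indep_families_imp_indep_var:
  assumes "indep_families I u G" "g \<in> G" "h \<in> G" "g \<noteq> h" "i \<in> I g" "j \<in> I h"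
  shows "indep_var borel (u g i) borel (u h j)"
proof -
  have "indep_var borel ((\<lambda>f. f i) \<circ> (\<lambda>\<omega>. \<lambda>i\<in>I g. u g i \<omega>))
      borel ((\<lambda>f. f j) \<circ> (\<lambda>\<omega>. \<lambda>i\<in>I h. u h i \<omega>))"
    using assms by (intro indep_var_compose[OF indep_vars_imp_indep_var[OF
          assms(1)[unfolded indep_families_def] assms(2-4)]]) measurable
  then show ?thesis
    using assms by (simp add: comp_def)
qed

lemma iid_random_variable: "iid D I u \<Longrightarrow> i \<in> I \<Longrightarrow> random_variable borel (u i)"
  by (auto simp: iid_def indep_vars_def)

text \<open>Two distinct observations lie either in one family, where the iid assumption makes them
  independent, or in two families, where \<open>indep_families\<close> does. On the diagonal the
  covariance is the variance.\<close>

lemma covariance_iid_families: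
  assumes iid: "\<And>g. g \<in> G \<Longrightarrow> iid (D g) (I g) (u g)"
    and indep: "indep_families I u G"
    and sd: "\<And>g i. g \<in> G \<Longrightarrow> i \<in> I g \<Longrightarrow> finite_sd (u g i)"
    and sd_eq: "\<And>g i. g \<in> G \<Longrightarrow> i \<in> I g \<Longrightarrow> sd (u g i) = \<sigma>"
    and "g \<in> G" "i \<in> I g" "h \<in> G" "j \<in> I h"
  shows "covariance (u g i) (u h j) = (if (g, i) = (h, j) then \<sigma>\<^sup>2 else 0)"
proof (cases "(g, i) = (h, j)")
  case True
  then show ?thesis using assms by (simp add: covariance_self)
next
  case False
  have "indep_var borel (u g i) borel (u h j)"
  proof (cases "g = h")
    case True
    then show ?thesis
      using False indep_vars_imp_indep_var[of "\<lambda>_. borel" "u g" "I g" i j] iid[of g] assms(5-8)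
      by (simp add: iid_def)
  next
    case False
    then show ?thesis
      using indep_families_imp_indep_var[OF indep] assms(5-8) by blast
  qed
  then show ?thesis
    using False sd assms(5-8) by (auto simp: finite_sd_def intro!: covariance_indep_var)
qed

end

text \<open>The model variable \<open>X\<close> lives on its own space \<open>N\<close>, while the
  sample lives on \<open>M\<close>; only the common distribution links them. The lemma serves each
  of the three groups in turn.\<close>

lemma iid_distr_finite_sd:
  fixes X :: "'b \<Rightarrow> real"
  assumes "prob_space M" "prob_space N" "prob_space.finite_sd N X"
    and "prob_space.iid M (distr N borel X) I u" "i \<in> I"
  shows "prob_space.finite_sd M (u i)" "prob_space.sd M (u i) = prob_space.sd N X"
proof -
  interpret M: prob_space M by fact
  interpret N: prob_space N by fact
  have "u i \<in> borel_measurable M" "X \<in> borel_measurable N"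
    "distr M borel (u i) = distr N borel X"
    using assms(3-) M.iid_random_variable[OF assms(4,5)] by (auto simp: M.iid_def N.finite_sd_def)
  with assms(1-3) show "M.finite_sd (u i)" "M.sd (u i) = N.sd X"
    using finite_sd_iff_of_distr_eq sd_eq_of_distr_eq by metis+
qed

section \<open>Covariance and variances of the two statistics\<close>

theorem proposition6:
  fixes M :: "'a measure"
    and MX :: "'b measure" and MY :: "'c measure" and MZ :: "'d measure"
    and X :: "'b \<Rightarrow> real" and Y :: "'c \<Rightarrow> real" and Z :: "'d \<Rightarrow> real"
    and x y z :: "nat \<Rightarrow> 'a \<Rightarrow> real"
    and n k :: nat and \<sigma> :: real and A B :: "nat set"
    and t1 t2 :: "'a \<Rightarrow> real"
  assumes "n \<ge> 1"
    and "prob_space M" and "prob_space MX" and "prob_space MY" and "prob_space MZ"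
    and "prob_space.finite_sd MX X" and "prob_space.finite_sd MY Y" and "prob_space.finite_sd MZ Z"
    and "\<sigma> = prob_space.sd MX X" and "\<sigma> = prob_space.sd MY Y" and "\<sigma> = prob_space.sd MZ Z"
    and "\<sigma> > 0"
    and "prob_space.iid M (distr MX borel X) {1..n} x"
    and "prob_space.iid M (distr MY borel Y) {1..2*n} y"
    and "prob_space.iid M (distr MZ borel Z) {1..n} z"
    and "prob_space.indep_families M
           (case_group_label {1..n} {1..2*n} {1..n}) (case_group_label x y z) {T1, C, T2}"
    and "A \<subseteq> {1..2*n}" and "card A = n"
    and "B \<subseteq> {1..2*n}" and "card B = n"
    and "k = card (A \<inter> B)"
    and "t1 = z_statistic n \<sigma> {1..n} x A y"
    and "t2 = z_statistic n \<sigma> {1..n} z B y"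
  shows "prob_space.covariance M t1 t2 = real k / (2 * real n)
       \<and> real k / (2 * real n) \<ge> 0
       \<and> prob_space.correlation M t1 t2 = real k / (2 * real n)"
proof -
  interpret prob_space M by fact
  define I where "I = case_group_label {1..n} {1..2*n} {1..n}"
  define u where "u = case_group_label x y z"
  define D where "D = case_group_label (distr MX borel X) (distr MY borel Y) (distr MZ borel Z)"
  define G where "G = {T1, C, T2}"
  define S where "S = Sigma G I"
  \<comment> \<open>The weight of a single observation: 1/n from the sample mean, divided by the
    standard error in the denominator of the statistic.\<close>
  define c where "c = 1 / (real n * sqrt (2 * \<sigma>\<^sup>2 * inverse (real n)))"
  \<comment> \<open>\<open>a\<close> and \<open>b\<close> are the coefficient vectors of
    \<open>t1\<close> and \<open>t2\<close>. Observations that a statistic does not involve get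
    coefficient 0, so that both statistics become sums over the same \<open>S\<close>.\<close>
  define a where "a p = (case p of (T1, i) \<Rightarrow> c | (C, i) \<Rightarrow> if i \<in> A then - c else 0 | (T2, i) \<Rightarrow> 0)"
    for p :: "group_label \<times> nat"
  define b where "b p = (case p of (T1, i) \<Rightarrow> 0 | (C, i) \<Rightarrow> if i \<in> B then - c else 0 | (T2, i) \<Rightarrow> c)"
    for p :: "group_label \<times> nat"
  have iid: "iid (D g) (I g) (u g)" if "g \<in> G" for g
    using assms(13-15) by (cases g) (simp_all add: D_def I_def u_def)
  have sd: "finite_sd (u g i) \<and> sd (u g i) = \<sigma>" if "g \<in> G" "i \<in> I g" for g i
    using that iid_distr_finite_sd[OF assms(2,3,6,13), of i]
      iid_distr_finite_sd[OF assms(2,4,7,14), of i] iid_distr_finite_sd[OF assms(2,5,8,15), of i]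
      assms(9-11)[symmetric]
    by (cases g) (simp_all add: I_def u_def)
  have "finite S"
    by (auto simp: S_def G_def I_def)
  have cov: "covariance (\<lambda>\<omega>. \<Sum>p\<in>S. f p * u (fst p) (snd p) \<omega>) (\<lambda>\<omega>. \<Sum>p\<in>S. h p * u (fst p) (snd p) \<omega>)
      = \<sigma>\<^sup>2 * (\<Sum>p\<in>S. f p * h p)" for f h
  proof (rule covariance_sum_uncorrelated[OF \<open>finite S\<close>])
    show "finite_sd (u (fst p) (snd p))" if "p \<in> S" for p
      using that sd by (auto simp: S_def)
    have "indep_families I u G"
      using assms(16) by (simp add: I_def u_def G_def)
    then have "covariance (u g i) (u h j) = (if (g, i) = (h, j) then \<sigma>\<^sup>2 else 0)"
      if "g \<in> G" "i \<in> I g" "h \<in> G" "j \<in> I h" for g i h j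
      by (rule covariance_iid_families[where D = D, rotated]) (use that in \<open>simp_all add: iid sd\<close>)
    then show "covariance (u (fst p) (snd p)) (u (fst q) (snd q)) = (if p = q then \<sigma>\<^sup>2 else 0)"
      if "p \<in> S" "q \<in> S" for p q
      using that by (cases p; cases q) (simp add: S_def)
  qed
  have sum_S: "(\<Sum>p\<in>S. f p) = (\<Sum>i=1..n. f (T1, i)) + (\<Sum>i=1..2*n. f (C, i)) + (\<Sum>i=1..n. f (T2, i))"
    for f :: "group_label \<times> nat \<Rightarrow> real"
    using sum.Sigma[of G I "\<lambda>g i. f (g, i)"] by (simp add: S_def G_def I_def)
  have sum_if: "(\<Sum>i=1..2*n. if i \<in> J then f i else 0) = (\<Sum>i\<in>J. f i)"
    if "J \<subseteq> {1..2*n}" for J and f :: "nat \<Rightarrow> real"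
    using that by (simp add: sum.inter_restrict[symmetric] Int_absorb1)
  have z_stat: "z_statistic n \<sigma> J v K w \<omega> = c * (\<Sum>i\<in>J. v i \<omega>) - c * (\<Sum>i\<in>K. w i \<omega>)"
    for J K and v w :: "nat \<Rightarrow> 'a \<Rightarrow> real" and \<omega>
    by (simp add: z_statistic_def sample_mean_def c_def diff_divide_distrib)
  have t1: "t1 = (\<lambda>\<omega>. \<Sum>p\<in>S. a p * u (fst p) (snd p) \<omega>)"
  proof
    fix \<omega>
    have "(\<Sum>i=1..2*n. a (C, i) * y i \<omega>) = (\<Sum>i=1..2*n. if i \<in> A then - c * y i \<omega> else 0)"
      by (intro sum.cong) (auto simp: a_def)
    also have "\<dots> = - c * (\<Sum>i\<in>A. y i \<omega>)"
      unfolding sum_if[OF assms(17)] by (simp only: sum_distrib_left)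
    finally have "(\<Sum>i=1..2*n. a (C, i) * y i \<omega>) = - c * (\<Sum>i\<in>A. y i \<omega>)" .
    moreover have "a (T1, i) = c" "a (T2, i) = 0" for i
      by (simp_all add: a_def)
    ultimately show "t1 \<omega> = (\<Sum>p\<in>S. a p * u (fst p) (snd p) \<omega>)"
      unfolding sum_S assms(22) z_stat by (simp add: u_def sum_distrib_left sum_negf)
  qed
  have t2: "t2 = (\<lambda>\<omega>. \<Sum>p\<in>S. b p * u (fst p) (snd p) \<omega>)"
  proof
    fix \<omega>
    have "(\<Sum>i=1..2*n. b (C, i) * y i \<omega>) = (\<Sum>i=1..2*n. if i \<in> B then - c * y i \<omega> else 0)"
      by (intro sum.cong) (auto simp: b_def)
    also have "\<dots> = - c * (\<Sum>i\<in>B. y i \<omega>)"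
      unfolding sum_if[OF assms(19)] by (simp only: sum_distrib_left)
    finally have "(\<Sum>i=1..2*n. b (C, i) * y i \<omega>) = - c * (\<Sum>i\<in>B. y i \<omega>)" .
    moreover have "b (T1, i) = 0" "b (T2, i) = c" for i
      by (simp_all add: b_def)
    ultimately show "t2 \<omega> = (\<Sum>p\<in>S. b p * u (fst p) (snd p) \<omega>)"
      unfolding sum_S assms(23) z_stat by (simp add: u_def sum_distrib_left sum_negf)
  qed
  have "(sqrt (2 * \<sigma>\<^sup>2 * inverse (real n)))\<^sup>2 = 2 * \<sigma>\<^sup>2 / real n"
    by (simp add: divide_inverse)
  then have "c\<^sup>2 = 1 / ((real n)\<^sup>2 * (2 * \<sigma>\<^sup>2 / real n))"
    unfolding c_def by (simp only: power_divide power_mult_distrib power_one)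
  also have "\<dots> = 1 / (2 * real n * \<sigma>\<^sup>2)"
    by (simp add: power2_eq_square[of "real n"])
  \<comment> \<open>The factor \<open>r\<close> counts the nonzero terms of an inner product:
    \<open>k\<close> for the covariance, \<open>2 * n\<close> for each variance.\<close>
  finally have c2: "\<sigma>\<^sup>2 * (r * c\<^sup>2) = r / (2 * real n)" for r
    using \<open>\<sigma> > 0\<close> by simp
  have sq: "(\<Sum>i=1..2*n. if i \<in> J then c\<^sup>2 else 0) = real (card J) * c\<^sup>2"
    if "J \<subseteq> {1..2*n}" for J
    using sum_if[OF that, of "\<lambda>_. c\<^sup>2"] by simp
  \<comment> \<open>On each treatment group one of the two vectors vanishes. A control unit
    contributes (-c)(-c) exactly when it lies in both \<open>A\<close> and \<open>B\<close>.\<close>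
  have "(\<Sum>p\<in>S. a p * b p) = (\<Sum>i=1..2*n. if i \<in> A \<inter> B then c\<^sup>2 else 0)"
    unfolding sum_S by (simp add: a_def b_def power2_eq_square) (auto simp: power2_eq_square intro!: sum.cong)
  also have "\<dots> = real k * c\<^sup>2"
    unfolding assms(21) using assms(17) by (intro sq) blast
  finally have cov12: "covariance t1 t2 = real k / (2 * real n)"
    unfolding t1 t2 cov by (simp add: c2)
  \<comment> \<open>The \<open>n\<close> treated units and the \<open>n\<close> controls in
    \<open>A\<close> contribute c^2 each, and c is scaled to make the total variance 1. The
    correlation then coincides with the covariance.\<close>
  have "(\<Sum>p\<in>S. a p * a p) = real n * c\<^sup>2 + (\<Sum>i=1..2*n. if i \<in> A then c\<^sup>2 else 0)"
    unfolding sum_S by (simp add: a_def power2_eq_square) (auto simp: power2_eq_square intro!: sum.cong)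
  also have "\<dots> = 2 * real n * c\<^sup>2"
    unfolding sq[OF assms(17)] assms(18) by simp
  finally have "covariance t1 t1 = 1"
    unfolding t1 cov using \<open>n \<ge> 1\<close> by (simp add: c2)
  then have sd1: "sd t1 = 1"
    by (simp add: sd_def covariance_def power2_eq_square)
  have "(\<Sum>p\<in>S. b p * b p) = real n * c\<^sup>2 + (\<Sum>i=1..2*n. if i \<in> B then c\<^sup>2 else 0)"
    unfolding sum_S by (simp add: b_def power2_eq_square) (auto simp: power2_eq_square intro!: sum.cong)
  also have "\<dots> = 2 * real n * c\<^sup>2"
    unfolding sq[OF assms(19)] assms(20) by simp
  finally have "covariance t2 t2 = 1"
    unfolding t2 cov using \<open>n \<ge> 1\<close> by (simp add: c2)
  then have sd2: "sd t2 = 1"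
    by (simp add: sd_def covariance_def power2_eq_square)
  show ?thesis
    using cov12 sd1 sd2 by (simp add: correlation_def)
qed

end
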